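(* For every integer $n\ge 1$, \[ a(n)\le \frac{5}{11}\Bigl[45^{\log_{10}\left(\frac{n+1}{5}\right)+1}-1\Bigr], \] and equality holds if and only if $n=5\cdot 10^{k}-1$ for some integer $k\ge 0$.
   Context: For a positive integer $p$, let $C(p)$ be the product of the decimal digits of $p$ (no leading zeros). For $n\ge 1$, $a(n)=\sum_{i=1}^{n}C(2i)$ is the sum of the products of the digits of the first $n$ positive even numbers $2,4,\dots,2n$. *)

theory Defs
  imports Complex_Main
begin

text \<open>Decimal digits of a positive integer, most significant first, without leading zeros
  (so \<open>0\<close> is mapped to the empty list; only positive arguments are used below).\<close>

fun decimal_digits :: "nat \<Rightarrow> nat list" where
  "decimal_digits p = (if p = 0 then [] else decimal_digits (p div 10) @ [p mod 10])"

declare decimal_digits.simps [simp del]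

definition digit_product :: "nat \<Rightarrow> nat" where
  "digit_product p = prod_list (decimal_digits p)"

definition even_digit_product_sum :: "nat \<Rightarrow> nat" where
  "even_digit_product_sum n = (\<Sum>i=1..n. digit_product (2 * i))"

end

theory Submission
  imports Defs "HOL-Analysis.Convex"
begin

text \<open>
  Write \<open>C\<close> for the digit product, \<open>T N\<close> for the sum of \<open>C q\<close> over \<open>q < N\<close> and \<open>\<theta> = log 10 45\<close>.
  The right-hand side of the theorem is \<open>5 / 11 * (N powr \<theta> - 1)\<close> with \<open>N = 2 * n + 2\<close>, so everything is
  about comparing digit sums with the power \<open>N powr \<theta>\<close>.

  Appending a digit gives \<open>T (10 * M + r) = 1 + 45 * T M + C M * (0 + 1 + \<dots> + (r - 1))\<close>. The affine
  change \<open>V = (44 * T + 1) / 45\<close> absorbs the constant: \<open>V (10 * M) = 45 * V M\<close>, hence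
  \<open>V (10 ^ k) = 45 ^ k = (10 ^ k) powr \<theta>\<close>. Summing even last digits only can be compared directly with
  \<open>V\<close>, and yields \<open>a n \<le> 5 / 11 * (V (2 * n + 2) - 1)\<close>. It remains to show \<open>V N \<le> N powr \<theta>\<close>, strictly
  unless \<open>N\<close> is a power of ten.

  Induction on digits does not work for this inequality itself: the power is convex, and the increments
  \<open>C M\<close> of \<open>V\<close> can be much larger than those of \<open>N powr \<theta>\<close>. What is inherited is an upper bound by an
  affine function. Because the digits \<open>0, 1, \<dots>, 9\<close> come in increasing order, \<open>V (10 * M + r)\<close> lies below
  the linear interpolation between \<open>45 * V M\<close> and \<open>45 * V (M + 1)\<close>. So an affine upper bound on \<open>V\<close> between
  \<open>d * 10 ^ k\<close> and \<open>(d + 1) * 10 ^ k\<close> passes to \<open>k + 1\<close>, and \<open>V N\<close> is at most \<open>45 ^ k\<close> times the chord of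
  \<open>V\<close> over \<open>{d..d + 1}\<close>, evaluated at \<open>N / 10 ^ k\<close> (\<open>normalized_sum_le_chord\<close>).

  This leaves a finite problem: for each leading digit \<open>d\<close> from 1 to 9 the chord lies below \<open>x powr \<theta>\<close> on
  \<open>{d..d + 1}\<close>, touching it only at \<open>x = 1\<close> and \<open>x = 10\<close> (\<open>chord_less_powr\<close>). The convex power lies
  above its tangents, and the tangents at 1, 5 and 10 suffice, up to rational bounds on \<open>\<theta>\<close>.
\<close>

section \<open>Digit products and their partial sums\<close>

lemma digit_product_append_digit:
  assumes "r < 10" and "0 < 10 * M + r"
  shows "digit_product (10 * M + r) = digit_product M * r"
proof -
  have "decimal_digits (10 * M + r) = decimal_digits M @ [r]"
    using assms by (subst decimal_digits.simps) auto
  then show ?thesis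
    by (simp add: digit_product_def)
qed

lemma digit_product_0: "digit_product 0 = 1"
  by (simp add: digit_product_def decimal_digits.simps)

text \<open>The first \<open>M * b + s\<close> indices form \<open>M\<close> complete blocks of length \<open>b\<close>, on each of which
  the quotient is constant, and an initial piece of the next block. With base 10 this separates the last
  digit of \<open>q\<close>; with base 5 it separates the last digit of \<open>2 * i\<close>.\<close>

lemma sum_div_mod_product:
  fixes g h :: "nat \<Rightarrow> nat"
  assumes "s \<le> b" and "0 < b"
  shows "(\<Sum>i<M * b + s. g (i div b) * h (i mod b))
           = (\<Sum>q<M. g q) * (\<Sum>j<b. h j) + g M * (\<Sum>j<s. h j)"
proof -
  have block: "(\<Sum>i\<in>{q * b..<q * b + t}. g (i div b) * h (i mod b)) = g q * (\<Sum>j<t. h j)"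
    if "t \<le> b" for q t
  proof -
    have "(\<Sum>i\<in>{q * b..<q * b + t}. g (i div b) * h (i mod b))
            = (\<Sum>j<t. g ((j + q * b) div b) * h ((j + q * b) mod b))"
      using sum.shift_bounds_nat_ivl[of "\<lambda>i. g (i div b) * h (i mod b)" 0 "q * b" t]
      by (simp add: atLeast0LessThan add.commute)
    also have "\<dots> = (\<Sum>j<t. g q * h j)"
      using that \<open>0 < b\<close> by (intro sum.cong) auto
    finally show ?thesis
      by (simp add: sum_distrib_left)
  qed
  have "(\<Sum>i<M * b + s. g (i div b) * h (i mod b))
          = (\<Sum>i<M * b. g (i div b) * h (i mod b))
            + (\<Sum>i\<in>{M * b..<M * b + s}. g (i div b) * h (i mod b))"
    using sum.atLeastLessThan_concat[of 0 "M * b" "M * b + s"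
        "\<lambda>i. g (i div b) * h (i mod b)"]
    by (simp add: atLeast0LessThan)
  moreover have "(\<Sum>i<M * b. g (i div b) * h (i mod b)) = (\<Sum>q<M. g q) * (\<Sum>j<b. h j)"
    by (simp add: sum.nat_group[symmetric] block sum_distrib_right)
  ultimately show ?thesis
    by (simp add: block assms)
qed

definition digit_product_sum :: "nat \<Rightarrow> nat" where
  "digit_product_sum N = (\<Sum>q<N. digit_product q)"

lemma digit_product_sum_append_digit:
  assumes "r < 10" and "0 < 10 * M + r"
  shows "real (digit_product_sum (10 * M + r))
           = 1 + 45 * real (digit_product_sum M) + real (digit_product M) * (real r * (real r - 1) / 2)"
proof -
  \<comment> \<open>At \<open>q = 0\<close> the product over the digits is empty, hence 1, while the formula with a last digit
    gives 0; this is the source of the summand 1.\<close>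
  have recurrence:
    "digit_product q = (if q = 0 then 1 else 0) + digit_product (q div 10) * (q mod 10)" for q
    using digit_product_append_digit[of "q mod 10" "q div 10"]
    by (cases "q = 0") (auto simp: digit_product_0)
  have "digit_product_sum (10 * M + r)
      = (\<Sum>q<10 * M + r. (if q = 0 then 1 else 0) + digit_product (q div 10) * (q mod 10))"
    unfolding digit_product_sum_def by (rule sum.cong[OF refl recurrence])
  also have "\<dots> = 1 + (\<Sum>q<M * 10 + r. digit_product (q div 10) * (q mod 10))"
    using assms by (simp add: sum.distrib mult.commute)
  also have "\<dots> = 1 + (digit_product_sum M * (\<Sum>j<10. j) + digit_product M * (\<Sum>j<r. j))"
    using assms by (subst sum_div_mod_product) (auto simp: digit_product_sum_def)
  finally have "digit_product_sum (10 * M + r)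
      = 1 + 45 * digit_product_sum M + digit_product M * (\<Sum>j<r. j)"
    by (simp add: lessThan_nat_numeral)
  moreover have "real (\<Sum>j<r. j) = real r * (real r - 1) / 2"
    by (induction r) (auto simp: field_simps)
  ultimately show ?thesis
    by simp
qed

lemma even_digit_product_sum_eq:
  assumes "s < 5" and "0 < 5 * M + s"
  shows "real (even_digit_product_sum (5 * M + s - 1))
           = 20 * real (digit_product_sum M) + real (digit_product M) * (real s * (real s - 1))"
proof -
  have digit: "digit_product (2 * i) = digit_product (i div 5) * (2 * (i mod 5))" if "0 < i" for i
  proof -
    have i: "2 * i = 10 * (i div 5) + 2 * (i mod 5)"
      using mult_div_mod_eq[of 5 i] by linarith
    have "digit_product (10 * (i div 5) + 2 * (i mod 5)) = digit_product (i div 5) * (2 * (i mod 5))"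
    proof (rule digit_product_append_digit)
      show "2 * (i mod 5) < 10"
        by simp
      show "0 < 10 * (i div 5) + 2 * (i mod 5)"
        using i that by linarith
    qed
    then show ?thesis
      by (simp only: i)
  qed
  have "even_digit_product_sum (5 * M + s - 1)
      = (\<Sum>i\<in>{1..<5 * M + s}. digit_product (i div 5) * (2 * (i mod 5)))"
    unfolding even_digit_product_sum_def using assms digit by (intro sum.cong) auto
  \<comment> \<open>The index \<open>i = 0\<close> may be added since its last digit makes the summand vanish.\<close>
  also have "\<dots> = (\<Sum>i<5 * M + s. digit_product (i div 5) * (2 * (i mod 5)))"
    by (rule sum.mono_neutral_left) (auto simp: not_less_eq_eq)
  also have "\<dots> = (\<Sum>i<M * 5 + s. digit_product (i div 5) * (2 * (i mod 5)))"
    by (simp add: mult.commute)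
  also have "\<dots> = digit_product_sum M * (\<Sum>j<5. 2 * j) + digit_product M * (\<Sum>j<s. 2 * j)"
    using assms by (subst sum_div_mod_product) (auto simp: digit_product_sum_def)
  finally have "even_digit_product_sum (5 * M + s - 1)
      = 20 * digit_product_sum M + digit_product M * (\<Sum>j<s. 2 * j)"
    by (simp add: lessThan_nat_numeral)
  moreover have "real (\<Sum>j<s. 2 * j) = real s * (real s - 1)"
    by (induction s) (auto simp: field_simps)
  ultimately show ?thesis
    by simp
qed

text \<open>The recurrence of \<open>digit_product_sum\<close> under \<open>M \<mapsto> 10 * M\<close> is \<open>t \<mapsto> 45 * t + 1\<close>, with fixed point
  \<open>- 1 / 44\<close>. Measured from this fixed point, and scaled to the value 1 at \<open>N = 1\<close>, the sum is
  multiplied by 45 exactly.\<close>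

definition normalized_sum :: "nat \<Rightarrow> real" where
  "normalized_sum N = (44 * real (digit_product_sum N) + 1) / 45"

lemma normalized_sum_append_digit:
  assumes "r < 10" and "0 < 10 * M + r"
  shows "normalized_sum (10 * M + r)
           = 45 * normalized_sum M + 22 / 45 * real (digit_product M) * (real r * (real r - 1))"
  unfolding normalized_sum_def digit_product_sum_append_digit[OF assms]
  by (simp add: field_simps)

lemma normalized_sum_times_10: "0 < M \<Longrightarrow> normalized_sum (10 * M) = 45 * normalized_sum M"
  using normalized_sum_append_digit[of 0 M] by simp

lemma normalized_sum_Suc:
  "normalized_sum (Suc N) = normalized_sum N + 44 / 45 * real (digit_product N)"
  by (simp add: normalized_sum_def digit_product_sum_def field_simps)

lemma normalized_sum_small:
  assumes "1 \<le> d" and "d \<le> 10"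
  shows "normalized_sum d = 1 + 22 / 45 * (real d * (real d - 1))"
proof -
  have base: "normalized_sum e = 1 + 22 / 45 * (real e * (real e - 1))" if "1 \<le> e" "e < 10" for e
    using normalized_sum_append_digit[of e 0] that
    by (simp add: digit_product_0 normalized_sum_def digit_product_sum_def)
  show ?thesis
  proof (cases "d = 10")
    case True
    then show ?thesis
      using normalized_sum_times_10[of 1] base[of 1] by simp
  qed (use base assms in auto)
qed

lemma normalized_sum_power_of_10: "normalized_sum (10 ^ k) = 45 ^ k"
  by (induction k) (auto simp: normalized_sum_times_10 normalized_sum_small)

section \<open>Chord bounds\<close>

text \<open>The increments of the sum within the block \<open>{10 * M..<10 * M + 10}\<close> are proportional to the last
  digit and therefore increase, so the sum is convex there and stays below the chord of the block. In
  numbers: \<open>r * (r - 1) / 90 \<le> r / 10\<close>.\<close>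

lemma normalized_sum_append_digit_le:
  assumes "r < 10" and "0 < M"
  shows "normalized_sum (10 * M + r)
           \<le> 45 * ((1 - real r / 10) * normalized_sum M + real r / 10 * normalized_sum (Suc M))"
proof -
  have "real r * (real r - 1) \<le> real r * 9"
    using assms by (intro mult_left_mono) auto
  then have "22 / 45 * real (digit_product M) * (real r * (real r - 1))
      \<le> 22 / 45 * real (digit_product M) * (real r * 9)"
    by (rule mult_left_mono) auto
  then show ?thesis
    using normalized_sum_append_digit[of r M] assms
    by (simp add: normalized_sum_Suc algebra_simps)
qed

definition chord :: "nat \<Rightarrow> real \<Rightarrow> real" where
  "chord d x = normalized_sum d + (x - real d) * (normalized_sum (Suc d) - normalized_sum d)"

lemma chord_convex_combination:
  "(1 - t) * chord d x + t * chord d y = chord d ((1 - t) * x + t * y)"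
  by (simp add: chord_def algebra_simps)

text \<open>Interpolating between two values that lie below an affine function stays below it. So the bound
  for \<open>k\<close> at the neighbours \<open>M\<close> and \<open>M + 1\<close> of \<open>N / 10\<close> gives the bound for \<open>k + 1\<close> at \<open>N\<close>; for \<open>k = 0\<close>
  only the two end points of the chord occur.\<close>

lemma normalized_sum_le_chord:
  assumes "0 < d" and "d * 10 ^ k \<le> N" and "N \<le> Suc d * 10 ^ k"
  shows "normalized_sum N \<le> 45 ^ k * chord d (real N / 10 ^ k)"
  using assms(2,3)
proof (induction k arbitrary: N)
  case 0
  then have "N = d \<or> N = Suc d"
    by auto
  then show ?case
    by (auto simp: chord_def)
next
  case (Suc k)
  define M r where "M = N div 10" and "r = N mod 10"
  have N: "N = 10 * M + r" and r: "r < 10"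
    by (auto simp: M_def r_def)
  have low: "d * 10 ^ k \<le> M"
    using Suc.prems N r by simp
  then have "0 < M"
    using \<open>0 < d\<close> by (auto intro: Nat.gr0I)
  have high: "M \<le> Suc d * 10 ^ k"
    using Suc.prems N by simp
  \<comment> \<open>\<open>M + 1\<close> can lie beyond the right end point, where the induction hypothesis is silent, but
    only if \<open>r = 0\<close>; then \<open>N = 10 * M\<close> and the bound at \<open>M\<close> alone suffices.\<close>
  show ?case
  proof (cases "r = 0")
    case True
    then show ?thesis
      using Suc.IH[OF low high] N \<open>0 < M\<close> by (simp add: normalized_sum_times_10)
  next
    case False
    then have high': "Suc M \<le> Suc d * 10 ^ k"
      using Suc.prems N by simp
    define t where "t = real r / 10"
    have t: "0 \<le> t" "t \<le> 1"
      using r by (auto simp: t_def)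
    have "normalized_sum N \<le> 45 * ((1 - t) * normalized_sum M + t * normalized_sum (Suc M))"
      using normalized_sum_append_digit_le[OF r \<open>0 < M\<close>] by (simp add: N t_def)
    also have "\<dots> \<le> 45 * ((1 - t) * (45 ^ k * chord d (real M / 10 ^ k))
                        + t * (45 ^ k * chord d (real (Suc M) / 10 ^ k)))"
      using t Suc.IH[OF low high] Suc.IH[OF _ high'] low
      by (intro mult_left_mono add_mono) auto
    also have "\<dots> = 45 ^ Suc k * ((1 - t) * chord d (real M / 10 ^ k)
                        + t * chord d (real (Suc M) / 10 ^ k))"
      by (simp add: algebra_simps)
    also have "\<dots> = 45 ^ Suc k * chord d ((1 - t) * (real M / 10 ^ k)
                        + t * (real (Suc M) / 10 ^ k))"
      by (simp only: chord_convex_combination)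
    also have "(1 - t) * (real M / 10 ^ k) + t * (real (Suc M) / 10 ^ k) = real N / 10 ^ Suc k"
      by (simp add: N t_def field_simps)
    finally show ?thesis .
  qed
qed

section \<open>The power function lies above the chords\<close>

lemma powr_ge_tangent:
  fixes x c p :: real
  assumes "0 < c" and "0 < x" and "1 \<le> p"
  shows "c powr p * (1 + p * (x / c - 1)) \<le> x powr p"
proof -
  have "p * c powr (p - 1) * (x - c) \<le> x powr p - c powr p"
  proof (rule f''_imp_f'[where C = "{0<..}" and f = "\<lambda>x. x powr p"
        and f'' = "\<lambda>x. p * (p - 1) * x powr (p - 2)"])
    show "((\<lambda>x. x powr p) has_real_derivative p * y powr (p - 1)) (at y)" if "y \<in> {0<..}" for y
      using that by (auto intro!: derivative_eq_intros)
    show "((\<lambda>x. p * x powr (p - 1)) has_real_derivative p * (p - 1) * y powr (p - 2)) (at y)"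
      if "y \<in> {0<..}" for y
      using that by (auto intro!: derivative_eq_intros)
  qed (use assms in auto)
  moreover have "c powr (p - 1) = c powr p / c"
    using \<open>0 < c\<close> by (simp add: powr_diff)
  ultimately show ?thesis
    using \<open>0 < c\<close> by (simp add: field_simps)
qed

text \<open>The two rational bounds come from \<open>10 ^ 13 \<le> 45 ^ 8\<close> and \<open>45 ^ 3 \<le> 10 ^ 5\<close>. They are close enough
  for the tangents at 1, 5 and 10.\<close>

lemma log_10_45_lower: "13 / 8 \<le> log 10 (45::real)"
proof -
  have "13 = log 10 ((10::real) ^ 13)"
    by (subst log_nat_power) auto
  also have "\<dots> \<le> log 10 (45 ^ 8)"
    by (subst log_le_cancel_iff) auto
  also have "\<dots> = 8 * log 10 45"
    by (subst log_nat_power) auto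
  finally show ?thesis
    by simp
qed

lemma log_10_45_upper: "log 10 (45::real) \<le> 5 / 3"
proof -
  have "3 * log 10 (45::real) = log 10 (45 ^ 3)"
    by (subst log_nat_power) auto
  also have "\<dots> \<le> log 10 ((10::real) ^ 5)"
    by (subst log_le_cancel_iff) auto
  also have "\<dots> = 5"
    by (subst log_nat_power) auto
  finally show ?thesis
    by simp
qed

lemma five_powr_lower: "27 / 2 \<le> 5 powr (13 / 8 :: real)"
proof -
  have "(27 / 2) ^ 8 \<le> (5::real) ^ 13"
    by (simp add: field_simps)
  also have "\<dots> = (5 powr (13 / 8)) ^ 8"
    by (simp add: powr_power)
  finally have "(27 / 2) ^ 8 \<le> (5 powr (13 / 8) :: real) ^ 8" .
  then show ?thesis
    by (subst (asm) power_mono_iff) auto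
qed

abbreviation (input) growth_exponent :: real where
  "growth_exponent \<equiv> log 10 45"

lemma chord_eq:
  assumes "1 \<le> d" and "d \<le> 9"
  shows "chord d x = 1 + 22 / 45 * (real d * (real d - 1)) + 44 / 45 * real d * (x - real d)"
  using assms unfolding chord_def by (simp add: normalized_sum_small field_simps)

text \<open>The bound is an equality at 1 and at 10, so near these points only the tangents there can work.
  They cover \<open>{1..3}\<close> and \<open>{7..10}\<close>. In the middle there is room to spare, and the tangent at 5 with the
  smaller exponent \<open>13 / 8\<close> is enough. Each comparison is between affine functions of \<open>x\<close>.\<close>

lemma chord_less_powr:
  assumes "1 \<le> d" and "d \<le> 9" and "real d \<le> x" and "x \<le> real (Suc d)" and "1 < x" and "x < 10"
  shows "chord d x < x powr growth_exponent"
proof -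
  note \<theta> = log_10_45_lower log_10_45_upper
  consider "d \<in> {1, 2}" | "d \<in> {3, 4, 5, 6}" | "d \<in> {7, 8, 9}"
    using assms(1,2) by force
  then show ?thesis
  proof cases
    case 1
    have "chord d x < 1 + 13 / 8 * (x - 1)"
      using 1 assms by (auto simp: chord_eq field_simps)
    also have "\<dots> \<le> 1 + growth_exponent * (x - 1)"
      using \<theta> assms by (intro add_left_mono mult_right_mono) auto
    also have "\<dots> \<le> x powr growth_exponent"
      using powr_ge_tangent[of 1 x growth_exponent] \<theta> assms by simp
    finally show ?thesis .
  next
    case 2
    have "chord d x < 27 / 2 * (1 + 13 / 8 * (x / 5 - 1))"
      using 2 assms by (auto simp: chord_eq field_simps)
    also have "\<dots> \<le> 5 powr (13 / 8) * (1 + 13 / 8 * (x / 5 - 1))"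
      using five_powr_lower 2 assms by (intro mult_right_mono) (auto simp: field_simps)
    also have "\<dots> \<le> x powr (13 / 8)"
      using assms by (intro powr_ge_tangent) auto
    also have "\<dots> \<le> x powr growth_exponent"
      using \<theta> assms by (intro powr_mono) auto
    finally show ?thesis .
  next
    case 3
    \<comment> \<open>Left of 10 a larger slope lowers the tangent, so here the upper bound on the exponent enters.\<close>
    have "chord d x < 45 * (1 + 5 / 3 * (x / 10 - 1))"
      using 3 assms by (auto simp: chord_eq field_simps)
    also have "\<dots> \<le> 45 * (1 + growth_exponent * (x / 10 - 1))"
      using \<theta> assms by (intro mult_left_mono add_left_mono mult_right_mono_neg) auto
    also have "\<dots> \<le> x powr growth_exponent"
      using powr_ge_tangent[of 10 x growth_exponent] \<theta> assms by simp
    finally show ?thesis .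
  qed
qed

section \<open>The sharp bound\<close>

lemma power_of_10_powr_growth_exponent: "(10 ^ k :: real) powr growth_exponent = 45 ^ k"
proof -
  have "(10 ^ k :: real) powr growth_exponent = (10 powr growth_exponent) powr real k"
    unfolding powr_realpow[of 10 k, symmetric, simplified] powr_powr by (simp only: mult.commute)
  then show ?thesis
    by (simp add: powr_realpow)
qed

text \<open>With \<open>x = N / 10 ^ k\<close> between 1 and 10 and \<open>d\<close> the leading digit of \<open>N\<close>, both sides scale by \<open>45 ^ k\<close>, and
  the comparison reduces to the one for the chord over \<open>{d..d + 1}\<close>. Powers of ten are exactly the case
  \<open>x = 1\<close>.\<close>

lemma normalized_sum_less_powr:
  assumes "0 < N" and "\<nexists>k. N = 10 ^ k"
  shows "normalized_sum N < real N powr growth_exponent"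
proof -
  obtain k where k: "10 ^ k \<le> N" "N < 10 ^ Suc k"
    using ex_power_ivl1[of 10 N] \<open>0 < N\<close> by auto
  define d where "d = N div 10 ^ k"
  have low: "d * 10 ^ k \<le> N"
    by (simp add: d_def)
  have high: "N < Suc d * 10 ^ k"
    using dividend_less_div_times[of "10 ^ k" N] by (simp add: d_def)
  have "0 < d"
    using k by (simp add: d_def div_greater_zero_iff)
  have "d < 10"
    using k by (simp add: d_def less_mult_imp_div_less)
  define x where "x = real N / 10 ^ k"
  have "N \<noteq> 10 ^ k"
    using assms by blast
  with k have "10 ^ k < N"
    by simp
  then have "real (10 ^ k) < real N" and "real N < real (10 ^ Suc k)"
    using k by (simp_all only: of_nat_less_iff)
  then have x: "1 < x" "x < 10"
    by (auto simp: x_def field_simps)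
  have "real (d * 10 ^ k) \<le> real N" and "real N \<le> real (Suc d * 10 ^ k)"
    using low high by (simp_all only: of_nat_le_iff)
  then have dx: "real d \<le> x" "x \<le> real (Suc d)"
    by (auto simp: x_def field_simps)
  have "normalized_sum N \<le> 45 ^ k * chord d x"
    unfolding x_def using \<open>0 < d\<close> low high by (intro normalized_sum_le_chord) auto
  also have "\<dots> < 45 ^ k * x powr growth_exponent"
    using chord_less_powr[of d x] \<open>0 < d\<close> \<open>d < 10\<close> dx x by simp
  also have "\<dots> = (10 ^ k * x) powr growth_exponent"
    using x by (simp add: powr_mult power_of_10_powr_growth_exponent)
  also have "10 ^ k * x = real N"
    by (simp add: x_def)
  finally show ?thesis .
qed

text \<open>For \<open>n + 1 = 5 * M + s\<close> the complete blocks contribute the same to both sides. The incomplete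
  block contributes the sum of the even digits below \<open>2 * s\<close> on the left and a multiple of the sum of all
  digits below \<open>2 * s\<close> on the right, and the inequality between the two is a check of the five values of \<open>s\<close>.\<close>

lemma even_digit_product_sum_le_normalized:
  "real (even_digit_product_sum n) \<le> 5 / 11 * (normalized_sum (2 * n + 2) - 1)"
proof -
  define M s where "M = (n + 1) div 5" and "s = (n + 1) mod 5"
  have n: "n + 1 = 5 * M + s" and s: "s < 5"
    by (auto simp: M_def s_def)
  have "real s * (real s - 1) \<le> 4 / 9 * (real s * (2 * real s - 1))"
  proof -
    have "s \<in> {0, 1, 2, 3, 4}"
      using s by auto
    then show ?thesis
      by auto
  qed
  then have "real (digit_product M) * (real s * (real s - 1))
      \<le> real (digit_product M) * (4 / 9 * (real s * (2 * real s - 1)))"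
    by (intro mult_left_mono) auto
  moreover have "real (even_digit_product_sum n)
      = 20 * real (digit_product_sum M) + real (digit_product M) * (real s * (real s - 1))"
    using even_digit_product_sum_eq[OF s, of M] n by (metis add_diff_cancel_right' zero_less_Suc Suc_eq_plus1)
  moreover have N: "2 * n + 2 = 10 * M + 2 * s"
    using n by simp
  have "normalized_sum (2 * n + 2) = 45 * normalized_sum M
      + 22 / 45 * real (digit_product M) * (real (2 * s) * (real (2 * s) - 1))"
    unfolding N using N s by (intro normalized_sum_append_digit) linarith+
  ultimately show ?thesis
    by (simp add: normalized_sum_def field_simps)
qed

lemma even_digit_product_sum_extremal:
  "real (even_digit_product_sum (5 * 10 ^ k - 1)) = 5 / 11 * (45 ^ Suc k - 1)"
proof -
  have "real (even_digit_product_sum (5 * 10 ^ k - 1)) = 20 * real (digit_product_sum (10 ^ k))"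
    using even_digit_product_sum_eq[of 0 "10 ^ k"] by simp
  moreover have "44 * real (digit_product_sum (10 ^ k)) + 1 = 45 ^ Suc k"
    using normalized_sum_power_of_10[of k] by (simp add: normalized_sum_def)
  ultimately show ?thesis
    by simp
qed

theorem theorem3:
  fixes n :: nat
  assumes "n \<ge> 1"
  shows "real (even_digit_product_sum n)
           \<le> 5 / 11 * (45 powr (log 10 ((real n + 1) / 5) + 1) - 1)
    \<and> (real (even_digit_product_sum n)
           = 5 / 11 * (45 powr (log 10 ((real n + 1) / 5) + 1) - 1)
         \<longleftrightarrow> (\<exists>k::nat. n = 5 * 10 ^ k - 1))"
proof -
  define N where "N = 2 * n + 2"
  \<comment> \<open>The right-hand side in the form of a power with exponent \<open>log 10 45\<close>.\<close>
  have "log 10 ((real n + 1) / 5) + 1 = log 10 ((real n + 1) / 5 * 10)"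
    by (subst log_mult) auto
  also have "(real n + 1) / 5 * 10 = real N"
    by (simp add: N_def)
  finally have rhs: "45 powr (log 10 ((real n + 1) / 5) + 1) = real N powr growth_exponent"
    by (simp add: powr_def log_def N_def)
  show ?thesis
  proof (cases "\<exists>k. n = 5 * 10 ^ k - 1")
    case True
    then obtain k where k: "n = 5 * 10 ^ k - 1"
      by blast
    then have "n + 1 = 5 * 10 ^ k"
      by simp
    then have "N = 10 ^ Suc k"
      by (simp add: N_def)
    then have "real N powr growth_exponent = 45 ^ Suc k"
      using power_of_10_powr_growth_exponent[of "Suc k"] by simp
    then have "real (even_digit_product_sum n) = 5 / 11 * (real N powr growth_exponent - 1)"
      using even_digit_product_sum_extremal[of k] by (simp add: k)
    with True show ?thesis
      unfolding rhs by simp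
  next
    case False
    have "\<nexists>j. N = 10 ^ j"
    proof
      assume "\<exists>j. N = 10 ^ j"
      then obtain j where j: "N = 10 ^ j"
        by blast
      \<comment> \<open>Since \<open>N \<ge> 4\<close>, the exponent is positive and the factor 10 can be split off.\<close>
      with \<open>n \<ge> 1\<close> obtain k where "j = Suc k"
        by (cases j) (auto simp: N_def)
      with j have "n = 5 * 10 ^ k - 1"
        by (simp add: N_def)
      with False show False
        by blast
    qed
    then have "normalized_sum N < real N powr growth_exponent"
      by (intro normalized_sum_less_powr) (auto simp: N_def)
    then have "real (even_digit_product_sum n) < 5 / 11 * (real N powr growth_exponent - 1)"
      using even_digit_product_sum_le_normalized[of n] by (simp add: N_def)
    with False show ?thesis
      unfolding rhs by simp
  qed
qed

end
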